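(* Let $\mathrm{Sud}_n$ denote the generalized Sudoku graph. As $n\to\infty$, \[ \overline{\mathrm{scs}}(\mathrm{Sud}_n)=n^4-\Omega(n^{10/3}); \] that is, there exist a constant $C>0$ and an integer $n_0$ such that $\overline{\mathrm{scs}}(\mathrm{Sud}_n)\le n^4-C\,n^{10/3}$ for all integers $n\ge n_0$.
   Context: $\mathrm{Sud}_n$ is the graph $(K_{n^2}\,\Box\,K_{n^2})\cup(nK_n\boxtimes nK_n)$, where $\Box$ is the Cartesian product, $\boxtimes$ the strong product, and the union is a union of edge sets on the common vertex set $[n^2]\times[n^2]$. Here $nK_n$ is the disjoint union of $n$ cliques on the blocks of $n$ consecutive elements of $[n^2]$. Explicitly, two distinct vertices $(a,b)$ and $(\alpha,\beta)$ are adjacent iff $a=\alpha$, or $b=\beta$, or both $\lceil a/n\rceil=\lceil\alpha/n\rceil$ and $\lceil b/n\rceil=\lceil\beta/n\rceil$. Its chromatic number is $n^2$. $[k]=\{1,\dots,k\}$ and $\chi(G)$ is the chromatic number of a graph $G=(V,E)$. For a proper coloring $c:V\to[\chi(G)]$, a determining set for $(G,c)$ is a set $S\subseteq V$ such that for every proper coloring $c':V\to[\chi(G)]$ of $G$, if $c'|_S=c|_S$ then $c'=c$ on all of $V$. A critical set for $(G,c)$ is a determining set for $(G,c)$ that is minimal under inclusion. Define $\mathrm{scs}(G,c)=\min\{|X| : X \text{ is a critical set for } (G,c)\}$ and $\overline{\mathrm{scs}}(G)=\max_c \mathrm{scs}(G,c)$, where the maximum is over all proper colorings $c:V\to[\chi(G)]$.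 *)

theory Defs
  imports Complex_Main "HOL-Library.FuncSet" "Graph_Theory.Pair_Digraph"
begin

text \<open>
  A finite simple graph is a \<^locale>\<open>pair_graph\<close>: an undirected edge is represented by its two
  opposite arcs.
\<close>

section \<open>Graph operations\<close>

definition clique_on :: "'a set \<Rightarrow> 'a pair_pre_digraph" where
  "clique_on A = \<lparr> pverts = A, parcs = {(u, v). u \<in> A \<and> v \<in> A \<and> u \<noteq> v} \<rparr>"

definition graph_Union :: "'i set \<Rightarrow> ('i \<Rightarrow> 'a pair_pre_digraph) \<Rightarrow> 'a pair_pre_digraph" where
  "graph_Union I G = \<lparr> pverts = (\<Union>i\<in>I. pverts (G i)), parcs = (\<Union>i\<in>I. parcs (G i)) \<rparr>"

definition graph_union :: "'a pair_pre_digraph \<Rightarrow> 'a pair_pre_digraph \<Rightarrow> 'a pair_pre_digraph" where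
  "graph_union G H = \<lparr> pverts = pverts G \<union> pverts H, parcs = parcs G \<union> parcs H \<rparr>"

definition cartesian_product ::
    "'a pair_pre_digraph \<Rightarrow> 'b pair_pre_digraph \<Rightarrow> ('a \<times> 'b) pair_pre_digraph" where
  "cartesian_product G H =
     \<lparr> pverts = pverts G \<times> pverts H,
       parcs = {((a, b), (a', b')).
         (a = a' \<and> a \<in> pverts G \<and> (b, b') \<in> parcs H) \<or>
         (b = b' \<and> b \<in> pverts H \<and> (a, a') \<in> parcs G)} \<rparr>"

definition strong_product ::
    "'a pair_pre_digraph \<Rightarrow> 'b pair_pre_digraph \<Rightarrow> ('a \<times> 'b) pair_pre_digraph" where
  "strong_product G H =
     \<lparr> pverts = pverts G \<times> pverts H,
       parcs = {((a, b), (a', b')).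
         (a, b) \<in> pverts G \<times> pverts H \<and> (a', b') \<in> pverts G \<times> pverts H \<and> (a, b) \<noteq> (a', b') \<and>
         (a = a' \<or> (a, a') \<in> parcs G) \<and> (b = b' \<or> (b, b') \<in> parcs H)} \<rparr>"

section \<open>The generalized Sudoku graph\<close>

definition block :: "nat \<Rightarrow> nat \<Rightarrow> nat set" where
  "block n i = {i * n + 1 .. (i + 1) * n}"

definition nK :: "nat \<Rightarrow> nat pair_pre_digraph" where
  "nK n = graph_Union {..<n} (\<lambda>i. clique_on (block n i))"

definition Sud :: "nat \<Rightarrow> (nat \<times> nat) pair_pre_digraph" where
  "Sud n = graph_union
     (cartesian_product (clique_on {1..n\<^sup>2}) (clique_on {1..n\<^sup>2}))
     (strong_product (nK n) (nK n))"

section \<open>Colorings, determining sets and critical sets\<close>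

text \<open>
  Colorings are extensional functions, so that there are only finitely many of them and
  equality of colorings is agreement on the vertex set.
\<close>

definition proper_colorings :: "'a pair_pre_digraph \<Rightarrow> nat \<Rightarrow> ('a \<Rightarrow> nat) set" where
  "proper_colorings G k =
     {c \<in> pverts G \<rightarrow>\<^sub>E {1..k}. \<forall>(u, v) \<in> parcs G. c u \<noteq> c v}"

definition chromatic_number :: "'a pair_pre_digraph \<Rightarrow> nat" where
  "chromatic_number G = (LEAST k. proper_colorings G k \<noteq> {})"

definition chromatic_colorings :: "'a pair_pre_digraph \<Rightarrow> ('a \<Rightarrow> nat) set" where
  "chromatic_colorings G = proper_colorings G (chromatic_number G)"

definition determining_set :: "'a pair_pre_digraph \<Rightarrow> ('a \<Rightarrow> nat) \<Rightarrow> 'a set \<Rightarrow> bool" where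
  "determining_set G c S \<longleftrightarrow> S \<subseteq> pverts G \<and>
     (\<forall>c' \<in> chromatic_colorings G. (\<forall>v \<in> S. c' v = c v) \<longrightarrow> (\<forall>v \<in> pverts G. c' v = c v))"

definition critical_set :: "'a pair_pre_digraph \<Rightarrow> ('a \<Rightarrow> nat) \<Rightarrow> 'a set \<Rightarrow> bool" where
  "critical_set G c S \<longleftrightarrow> determining_set G c S \<and> (\<forall>T. T \<subset> S \<longrightarrow> \<not> determining_set G c T)"

definition scs :: "'a pair_pre_digraph \<Rightarrow> ('a \<Rightarrow> nat) \<Rightarrow> nat" where
  "scs G c = Min {card X |X. critical_set G c X}"

definition scs_bar :: "'a pair_pre_digraph \<Rightarrow> nat" where
  "scs_bar G = Max {scs G c |c. c \<in> chromatic_colorings G}"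

section \<open>Adequacy of the definitions\<close>

lemma in_block_iff:
  assumes "n > 0"
  shows "a \<in> block n i \<longleftrightarrow> \<lceil>real a / real n\<rceil> = int i + 1"
proof -
  have "\<lceil>real a / real n\<rceil> = int i + 1 \<longleftrightarrow> real i < real a / real n \<and> real a / real n \<le> real i + 1"
    by (simp add: ceiling_eq_iff)
  also have "\<dots> \<longleftrightarrow> real (i * n) < real a \<and> real a \<le> real ((i + 1) * n)"
    using assms by (simp add: field_simps)
  also have "\<dots> \<longleftrightarrow> i * n < a \<and> a \<le> (i + 1) * n"
    by (simp only: of_nat_less_iff of_nat_le_iff)
  finally show ?thesis by (auto simp: block_def)
qed

lemma Union_block: "(\<Union>i<n. block n i) = {1..n\<^sup>2}"
proof (intro set_eqI iffI)
  fix a assume "a \<in> (\<Union>i<n. block n i)"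
  then obtain i where i: "i < n" "i * n + 1 \<le> a" "a \<le> (i + 1) * n" by (auto simp: block_def)
  from i(1) have "(i + 1) * n \<le> n * n" by (intro mult_right_mono) auto
  with i show "a \<in> {1..n\<^sup>2}" by (simp add: power2_eq_square)
next
  fix a assume a: "a \<in> {1..n\<^sup>2}"
  then have n: "n > 0" by (cases n) auto
  have "a - 1 < n * n" using a by (simp add: power2_eq_square) linarith
  then have "(a - 1) div n < n" by (simp add: less_mult_imp_div_less)
  moreover have "a \<in> block n ((a - 1) div n)"
  proof -
    have "(a - 1) div n * n \<le> a - 1" by (rule div_times_less_eq_dividend)
    then have "(a - 1) div n * n + 1 \<le> a" using a by (simp only: atLeastAtMost_iff) linarith
    moreover have "a \<le> ((a - 1) div n + 1) * n"
      using n a dividend_less_div_times[of n "a - 1"] by simp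
    ultimately show ?thesis by (simp add: block_def)
  qed
  ultimately show "a \<in> (\<Union>i<n. block n i)" by blast
qed

lemma pverts_nK: "pverts (nK n) = {1..n\<^sup>2}"
  using Union_block[of n] by (simp add: nK_def graph_Union_def clique_on_def)

lemma parcs_nK:
  "(a, b) \<in> parcs (nK n) \<longleftrightarrow>
     a \<in> {1..n\<^sup>2} \<and> b \<in> {1..n\<^sup>2} \<and> a \<noteq> b \<and> \<lceil>real a / real n\<rceil> = \<lceil>real b / real n\<rceil>"
proof -
  have "(a, b) \<in> parcs (nK n) \<longleftrightarrow> (\<exists>i<n. a \<in> block n i \<and> b \<in> block n i) \<and> a \<noteq> b"
    by (auto simp: nK_def graph_Union_def clique_on_def)
  also have "(\<exists>i<n. a \<in> block n i \<and> b \<in> block n i) \<longleftrightarrow>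
      a \<in> (\<Union>i<n. block n i) \<and> b \<in> (\<Union>i<n. block n i) \<and> \<lceil>real a / real n\<rceil> = \<lceil>real b / real n\<rceil>"
    by (cases "n > 0") (auto simp: in_block_iff)
  finally show ?thesis unfolding Union_block by blast
qed

lemma pverts_Sud: "pverts (Sud n) = {1..n\<^sup>2} \<times> {1..n\<^sup>2}"
  by (simp add: Sud_def graph_union_def cartesian_product_def strong_product_def pverts_nK)
     (simp add: clique_on_def)

lemma Sud_adjacent_iff:
  assumes "(a, b) \<in> pverts (Sud n)" "(\<alpha>, \<beta>) \<in> pverts (Sud n)" "(a, b) \<noteq> (\<alpha>, \<beta>)"
  shows "((a, b), (\<alpha>, \<beta>)) \<in> parcs (Sud n) \<longleftrightarrow>
    a = \<alpha> \<or> b = \<beta> \<or>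
    (\<lceil>real a / real n\<rceil> = \<lceil>real \<alpha> / real n\<rceil> \<and> \<lceil>real b / real n\<rceil> = \<lceil>real \<beta> / real n\<rceil>)"
  using assms unfolding pverts_Sud
  by (auto simp: Sud_def graph_union_def cartesian_product_def strong_product_def
      pverts_nK parcs_nK clique_on_def)

lemma pair_graph_Sud: "pair_graph (Sud n)"
proof -
  have sub: "parcs (Sud n) \<subseteq> pverts (Sud n) \<times> pverts (Sud n)"
    unfolding pverts_Sud
    by (auto simp: Sud_def graph_union_def cartesian_product_def strong_product_def
        pverts_nK clique_on_def)
  have fin: "finite (pverts (Sud n))" by (simp add: pverts_Sud)
  have "sym (parcs (Sud n))"
    by (rule symI)
       (auto simp: Sud_def graph_union_def cartesian_product_def strong_product_def
        pverts_nK parcs_nK clique_on_def)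
  moreover have "u \<noteq> v" if "(u, v) \<in> parcs (Sud n)" for u v
    using that
    by (auto simp: Sud_def graph_union_def cartesian_product_def strong_product_def clique_on_def)
  moreover have "finite (parcs (Sud n))"
    using sub fin by (meson finite_SigmaI finite_subset)
  ultimately show ?thesis
    using sub fin by unfold_locales (auto simp: symmetric_def)
qed

text \<open>
  For finite simple graphs, the minima and maxima above range over finite non-empty sets.
\<close>

lemma (in pair_graph) chromatic_colorings_nonempty: "chromatic_colorings G \<noteq> {}"
proof -
  obtain f :: "'a \<Rightarrow> nat" where f: "inj_on f (pverts G)" "f ` pverts G = {0..<card (pverts G)}"
    using ex_bij_betw_finite_nat[OF pair_finite_verts] by (auto simp: bij_betw_def)
  define c where "c = restrict (\<lambda>v. Suc (f v)) (pverts G)"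
  have "c \<in> pverts G \<rightarrow>\<^sub>E {1..card (pverts G)}" using f(2) by (auto simp: c_def Suc_le_eq)
  moreover have "c u \<noteq> c v" if "(u, v) \<in> parcs G" for u v
    using that in_arcsD1[OF that] in_arcsD2[OF that] pair_no_loops[OF that] f(1)
    by (auto simp: c_def inj_on_def)
  ultimately have "proper_colorings G (card (pverts G)) \<noteq> {}"
    by (auto simp: proper_colorings_def)
  then show ?thesis
    unfolding chromatic_colorings_def chromatic_number_def by (rule LeastI)
qed

lemma (in pair_graph) finite_chromatic_colorings: "finite (chromatic_colorings G)"
  unfolding chromatic_colorings_def proper_colorings_def
  by (rule finite_subset[of _ "pverts G \<rightarrow>\<^sub>E {1..chromatic_number G}"])
     (auto intro: finite_PiE pair_finite_verts)

lemma (in pair_graph) finite_critical_sets: "finite {X. critical_set G c X}"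
  by (rule finite_subset[of _ "Pow (pverts G)"])
     (auto simp: critical_set_def determining_set_def pair_finite_verts)

lemma (in pair_graph) ex_critical_set: "\<exists>X. critical_set G c X"
proof -
  let ?D = "{S. determining_set G c S}"
  have "finite ?D"
    by (rule finite_subset[of _ "Pow (pverts G)"])
       (auto simp: determining_set_def pair_finite_verts)
  moreover have "pverts G \<in> ?D" by (auto simp: determining_set_def)
  ultimately obtain X where "X \<in> ?D" "\<And>T. T \<in> ?D \<Longrightarrow> T \<subseteq> X \<Longrightarrow> X = T"
    using finite_has_minimal[of ?D] by blast
  then show ?thesis unfolding critical_set_def by blast
qed

end

theory Submission
  imports Defs
begin

text \<open>
  Put \<open>N = n\<^sup>2\<close> and choose a random set \<open>U\<close> of cells, each cell with probability \<open>p = 1 / q\<close> of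
  order \<open>N powr (- 1 / 3)\<close>. In a colored Sudoku, each color \<open>k\<close> other than that of a cell \<open>u\<close>
  occurs in the row, in the column and in the block of \<open>u\<close>, and these occurrences are three
  different cells except for at most \<open>2 n\<close> values of \<open>k\<close>. Hence the expected number of colors all of
  whose occurrences around \<open>u\<close> lie in \<open>U\<close> is at most \<open>N p ^ 3 + 2 n p\<^sup>2 \<le> 5 / 8\<close>. Keep the cells of
  \<open>U\<close> for which there is no such color: each of them is forced by the cells outside \<open>U\<close>, and on
  average at least \<open>3 / 8 * p N\<^sup>2\<close> of them are kept.
\<close>

section \<open>Random subsets\<close>

text \<open>A uniformly random \<open>f\<close> in \<open>V \<rightarrow>\<^sub>E {..<q}\<close>
  encodes the random set \<open>{x \<in> V. f x = 0}\<close>, which contains each element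
  independently with probability \<open>1 / q\<close>. The right-hand side is the number of
  functions times the probability that this set contains \<open>S\<close>.\<close>

lemma sum_of_bool_zero_on:
  assumes "finite V" "S \<subseteq> V" "q > 0"
  shows "(\<Sum>f\<in>V \<rightarrow>\<^sub>E {..<q::nat}. of_bool (\<forall>x\<in>S. f x = 0)) = real q ^ card V * (1 / real q) ^ card S"
proof -
  have "{f \<in> V \<rightarrow>\<^sub>E {..<q}. \<forall>x\<in>S. f x = 0} = PiE V (\<lambda>x. if x \<in> S then {0} else {..<q})"
    using assms(2,3) by (fastforce simp: PiE_def Pi_def split: if_splits)
  then have "card {f \<in> V \<rightarrow>\<^sub>E {..<q}. \<forall>x\<in>S. f x = 0} = (\<Prod>x\<in>V. if x \<in> S then 1 else q)"
    using assms(1) by (simp add: card_PiE if_distrib cong: if_cong)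
  also have "\<dots> = q ^ card (V - S)"
    using assms(1) by (simp add: prod.If_cases Diff_eq Compl_eq)
  finally have "real (card {f \<in> V \<rightarrow>\<^sub>E {..<q}. \<forall>x\<in>S. f x = 0}) = real q ^ (card V - card S)"
    using assms by (simp add: card_Diff_subset finite_subset)
  moreover have "(\<Sum>f\<in>V \<rightarrow>\<^sub>E {..<q}. of_bool (\<forall>x\<in>S. f x = 0))
      = real (card {f \<in> V \<rightarrow>\<^sub>E {..<q}. \<forall>x\<in>S. f x = 0})"
    using assms(1) by (simp add: finite_PiE Int_def)
  moreover have "card S \<le> card V" using assms by (simp add: card_mono)
  ultimately show ?thesis
    using assms(3) by (simp add: power_diff power_one_over)
qed

text \<open>First moment method with deletion: sample a random set and discard each sampled
  \<open>v\<close> for which some \<open>T v k\<close> is entirely sampled. By the union bound the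
  expected number of survivors is at least the stated sum, and some outcome reaches the expectation.
  The exponent counts \<open>insert v (T v k)\<close> because \<open>v\<close> itself must be
  sampled too.\<close>

lemma ex_subset_avoiding:
  fixes T :: "'a \<Rightarrow> 'b \<Rightarrow> 'a set"
  assumes V: "finite V" and q: "q > 0"
    and K: "\<And>v. v \<in> V \<Longrightarrow> finite (K v)"
    and T: "\<And>v k. v \<in> V \<Longrightarrow> k \<in> K v \<Longrightarrow> T v k \<subseteq> V"
  obtains W where "W \<subseteq> V" "\<And>v k. v \<in> W \<Longrightarrow> k \<in> K v \<Longrightarrow> \<not> T v k \<subseteq> W"
    "real (card W) \<ge>
      (\<Sum>v\<in>V. 1 / real q - (\<Sum>k\<in>K v. (1 / real q) ^ card (insert v (T v k))))"
proof -
  define F where "F = V \<rightarrow>\<^sub>E {..<q}"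
  \<comment> \<open>Survival is tested against the whole sampled set, of which \<open>W f\<close> is
    a subset, so an unsampled element of \<open>T v k\<close> also lies outside
    \<open>W f\<close>.\<close>
  define W where "W f = {v \<in> V. f v = 0 \<and> (\<forall>k\<in>K v. \<exists>x\<in>T v k. f x \<noteq> 0)}" for f :: "'a \<Rightarrow> nat"
  let ?m = "\<Sum>v\<in>V. 1 / real q - (\<Sum>k\<in>K v. (1 / real q) ^ card (insert v (T v k)))"
  have F: "finite F" "real (card F) = real q ^ card V"
    unfolding F_def using V by (auto simp: finite_PiE card_PiE)
  \<comment> \<open>The union bound, pointwise in \<open>f\<close>: a sampled vertex that is
    discarded has at least one bad \<open>k\<close> to cancel its contribution.\<close>
  have pt: "of_bool (v \<in> W f) \<ge>
      (of_bool (\<forall>x\<in>{v}. f x = 0) - (\<Sum>k\<in>K v. of_bool (\<forall>x\<in>insert v (T v k). f x = 0)) :: real)"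
    if v: "v \<in> V" for v f
  proof (cases "v \<in> W f \<or> f v \<noteq> 0")
    case True
    have "(\<Sum>k\<in>K v. of_bool (\<forall>x\<in>insert v (T v k). f x = 0)) \<ge> (0::real)"
      by (rule sum_nonneg) simp
    with True show ?thesis by (auto simp: W_def simp del: sum_of_bool_eq)
  next
    case False
    with v obtain k where k: "k \<in> K v" "\<forall>x\<in>insert v (T v k). f x = 0" by (auto simp: W_def)
    have "of_bool (\<forall>x\<in>insert v (T v k). f x = 0) \<le>
        (\<Sum>k\<in>K v. of_bool (\<forall>x\<in>insert v (T v k). f x = 0) :: real)"
      by (rule member_le_sum[OF k(1)]) (use K v in auto)
    with k False show ?thesis by (simp del: sum_of_bool_eq)
  qed
  have "real (card F) * ?m = (\<Sum>v\<in>V. real q ^ card V * (1 / real q) ^ card {v}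
      - (\<Sum>k\<in>K v. real q ^ card V * (1 / real q) ^ card (insert v (T v k))))"
    unfolding F(2) by (simp add: sum_distrib_left right_diff_distrib)
  also have "\<dots> = (\<Sum>v\<in>V. (\<Sum>f\<in>F. of_bool (\<forall>x\<in>{v}. f x = 0))
      - (\<Sum>k\<in>K v. \<Sum>f\<in>F. of_bool (\<forall>x\<in>insert v (T v k). f x = 0)))"
    unfolding F_def using T
    by (intro sum.cong refl arg_cong2[where f = "(-)"] sum_of_bool_zero_on[OF V _ q, symmetric]) auto
  also have "\<dots> = (\<Sum>v\<in>V. \<Sum>f\<in>F. of_bool (\<forall>x\<in>{v}. f x = 0)
      - (\<Sum>k\<in>K v. of_bool (\<forall>x\<in>insert v (T v k). f x = 0)))"
    by (subst sum.swap) (simp only: sum_subtractf)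
  also have "\<dots> \<le> (\<Sum>v\<in>V. \<Sum>f\<in>F. of_bool (v \<in> W f))"
    by (intro sum_mono pt)
  also have "\<dots> = (\<Sum>f\<in>F. \<Sum>v\<in>V. of_bool (v \<in> W f))" by (rule sum.swap)
  also have "\<dots> = (\<Sum>f\<in>F. real (card (W f)))"
    using V by (intro sum.cong refl) (auto simp: W_def intro!: arg_cong[where f = card])
  finally have le: "real (card F) * ?m \<le> (\<Sum>f\<in>F. real (card (W f)))" .
  \<comment> \<open>Averaging: if every outcome fell below \<open>?m\<close>, so would the mean over
    \<open>F\<close>.\<close>
  have "\<exists>f\<in>F. real (card (W f)) \<ge> ?m"
  proof (rule ccontr)
    assume "\<not> ?thesis"
    moreover have "F \<noteq> {}" using F q by auto
    ultimately have "(\<Sum>f\<in>F. real (card (W f))) < (\<Sum>f\<in>F. ?m)"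
      using F(1) by (intro sum_strict_mono) auto
    with le show False by simp
  qed
  then obtain f where "f \<in> F" "real (card (W f)) \<ge> ?m" ..
  moreover have "\<not> T v k \<subseteq> W f" if vk: "v \<in> W f" "k \<in> K v" for v k
  proof -
    obtain x where "x \<in> T v k" "f x \<noteq> 0" using vk unfolding W_def by blast
    then show ?thesis by (auto simp: W_def)
  qed
  ultimately show ?thesis by (intro that[of "W f"]) (auto simp: W_def)
qed

section \<open>Critical sets\<close>

text \<open>An inclusion-minimal determining subset of \<open>S\<close> is minimal among all
  determining sets, hence critical. Upper bounds on \<open>scs\<close> thus only need a small
  determining set.\<close>

lemma (in pair_graph) scs_le_card_determining:
  assumes "determining_set G c S"
  shows "scs G c \<le> card S"
proof -
  have finV: "finite (pverts G)" by (rule pair_finite_verts)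
  have S: "finite S" using assms finV by (auto simp: determining_set_def intro: finite_subset)
  let ?D = "{T. T \<subseteq> S \<and> determining_set G c T}"
  have "finite ?D" using S by simp
  moreover have "S \<in> ?D" using assms by simp
  ultimately obtain X where X: "X \<in> ?D" "\<forall>T\<in>?D. T \<subseteq> X \<longrightarrow> X = T"
    using finite_has_minimal[of ?D] by (metis (no_types, lifting) empty_iff)
  have "\<not> determining_set G c T" if "T \<subset> X" for T
  proof
    assume "determining_set G c T"
    then have "T \<in> ?D" using X(1) that by auto
    with X(2) that show False by (metis psubsetE subset_refl)
  qed
  with X(1) have "critical_set G c X" by (simp add: critical_set_def)
  then have "scs G c \<le> card X"
    unfolding scs_def using finite_critical_sets[of c] by (intro Min_le) auto
  also have "\<dots> \<le> card S" using X(1) S by (auto intro: card_mono)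
  finally show ?thesis .
qed

lemma (in pair_graph) scs_bar_attained:
  obtains c where "c \<in> chromatic_colorings G" "scs_bar G = scs G c"
proof -
  have "scs_bar G \<in> {scs G c |c. c \<in> chromatic_colorings G}"
    unfolding scs_bar_def
    using finite_chromatic_colorings chromatic_colorings_nonempty by (intro Max_in) auto
  then show ?thesis using that by blast
qed

text \<open>Every vertex of \<open>W\<close> is forced at once by its neighbors outside
  \<open>W\<close>: any color other than \<open>c u\<close> already occurs on one of them, where
  \<open>c'\<close> agrees with \<open>c\<close>.\<close>

lemma determining_set_Diff:
  assumes c: "c \<in> chromatic_colorings G" and W: "W \<subseteq> pverts G"
    and forced: "\<And>u k. u \<in> W \<Longrightarrow> k \<in> {1..chromatic_number G} - {c u} \<Longrightarrow>
      \<exists>w \<in> pverts G - W. (u, w) \<in> parcs G \<and> c w = k"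
  shows "determining_set G c (pverts G - W)"
  unfolding determining_set_def
proof (intro conjI ballI impI)
  fix c' v assume c': "c' \<in> chromatic_colorings G" "\<forall>v\<in>pverts G - W. c' v = c v"
    and v: "v \<in> pverts G"
  show "c' v = c v"
  proof (rule ccontr)
    assume ne: "c' v \<noteq> c v"
    with c' v have "v \<in> W" by auto
    moreover have "c' v \<in> {1..chromatic_number G} - {c v}"
      using c'(1) v ne by (auto simp: chromatic_colorings_def proper_colorings_def)
    ultimately obtain w where "w \<in> pverts G - W" "(v, w) \<in> parcs G" "c w = c' v"
      using forced by blast
    then show False
      using c' by (auto simp: chromatic_colorings_def proper_colorings_def)
  qed
qed auto

section \<open>The Sudoku graph\<close>

text \<open>Translates the one-based block index into a zero-based quotient, which suits modular
  arithmetic.\<close>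

lemma ceiling_divide_eq:
  assumes "n > 0" "a \<ge> 1"
  shows "\<lceil>real a / real n\<rceil> = int ((a - 1) div n) + 1"
proof -
  have "(a - 1) div n * n + 1 \<le> a"
    using assms div_times_less_eq_dividend[of "a - 1" n] by linarith
  moreover have "a \<le> ((a - 1) div n + 1) * n"
    using assms dividend_less_div_times[of n "a - 1"] by simp
  ultimately have "a \<in> block n ((a - 1) div n)" by (simp add: block_def)
  then show ?thesis using in_block_iff[OF assms(1)] by blast
qed

lemma card_block: "card (block n i) = n"
  by (simp add: block_def)

lemma block_subset: "i < n \<Longrightarrow> block n i \<subseteq> {1..n\<^sup>2}"
  using Union_block[of n] by blast

lemma Sud_row_adjacent:
  "a \<in> {1..n\<^sup>2} \<Longrightarrow> u \<in> {a} \<times> {1..n\<^sup>2} \<Longrightarrow> v \<in> {a} \<times> {1..n\<^sup>2} \<Longrightarrow> u \<noteq> v \<Longrightarrow> (u, v) \<in> parcs (Sud n)"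
  by (cases u; cases v) (simp add: Sud_adjacent_iff pverts_Sud)

lemma Sud_column_adjacent:
  "b \<in> {1..n\<^sup>2} \<Longrightarrow> u \<in> {1..n\<^sup>2} \<times> {b} \<Longrightarrow> v \<in> {1..n\<^sup>2} \<times> {b} \<Longrightarrow> u \<noteq> v \<Longrightarrow> (u, v) \<in> parcs (Sud n)"
  by (cases u; cases v) (simp add: Sud_adjacent_iff pverts_Sud)

lemma Sud_block_adjacent:
  assumes "i < n" "j < n" "u \<in> block n i \<times> block n j" "v \<in> block n i \<times> block n j" "u \<noteq> v"
  shows "(u, v) \<in> parcs (Sud n)"
proof -
  have "n > 0" using assms by simp
  moreover have "u \<in> pverts (Sud n)" "v \<in> pverts (Sud n)"
    using assms block_subset[of i n] block_subset[of j n] by (auto simp: pverts_Sud)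
  ultimately show ?thesis
    using assms by (cases u; cases v) (auto simp: Sud_adjacent_iff in_block_iff)
qed

section \<open>An explicit proper coloring and the chromatic number\<close>

lemma add_mod_cancel:
  assumes "(x + y) mod n = (x + z) mod n" "y < n" "z < (n::nat)"
  shows "y = z"
proof -
  have "y' \<le> z'" if "(x + y') mod n = (x + z') mod n" "y' < n" for y' z'
  proof (rule ccontr)
    assume "\<not> y' \<le> z'"
    with that(1) have "n dvd y' - z'" using mod_eq_dvd_iff_nat[of "x + z'" "x + y'" n] by simp
    with \<open>\<not> y' \<le> z'\<close> that(2) show False by (auto dest!: dvd_imp_le)
  qed
  from this[of y z] this[of z y] assms show ?thesis by simp
qed

lemma proper_colorings_Sud_nonempty:
  assumes n: "n > 0"
  shows "proper_colorings (Sud n) (n\<^sup>2) \<noteq> {}"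
proof -
  \<comment> \<open>Fixing the row, the column or the block of \<open>(a, b)\<close> fixes one summand in each of the two
    base \<open>n\<close> digits of \<open>g a b\<close>, so that these digits determine the other summands.\<close>
  define g where "g a b = n * (((a - 1) mod n + (b - 1) div n) mod n) +
      ((b - 1) mod n + (a - 1) div n) mod n" for a b :: nat
  define c where "c = restrict (\<lambda>(a, b). g a b + 1) (pverts (Sud n))"
  have "g a b < n\<^sup>2" for a b
  proof -
    have "n * x + y < n * n" if "x < n" "y < n" for x y
    proof -
      have "n * x + y < n * (x + 1)" using that by simp
      also have "\<dots> \<le> n * n" using that by (intro mult_left_mono) auto
      finally show ?thesis .
    qed
    then show ?thesis using n by (simp add: g_def power2_eq_square)
  qed
  then have "c \<in> pverts (Sud n) \<rightarrow>\<^sub>E {1..n\<^sup>2}" by (auto simp: c_def Suc_le_eq)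
  moreover have "c u \<noteq> c v" if uv: "(u, v) \<in> parcs (Sud n)" for u v
  proof
    assume eq: "c u = c v"
    obtain a b \<alpha> \<beta> where [simp]: "u = (a, b)" "v = (\<alpha>, \<beta>)" by (cases u; cases v)
    interpret pair_graph "Sud n" by (rule pair_graph_Sud)
    have V: "(a, b) \<in> pverts (Sud n)" "(\<alpha>, \<beta>) \<in> pverts (Sud n)" "(a, b) \<noteq> (\<alpha>, \<beta>)"
      using in_arcsD1[OF uv] in_arcsD2[OF uv] pair_no_loops[OF uv] by auto
    have pos: "a \<ge> 1" "b \<ge> 1" "\<alpha> \<ge> 1" "\<beta> \<ge> 1" using V by (auto simp: pverts_Sud)
    have lt: "(x - 1) div n < n" if "x \<in> {1..n\<^sup>2}" for x
      using that n by (intro less_mult_imp_div_less) (auto simp: power2_eq_square)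
    have lts: "(a - 1) div n < n" "(b - 1) div n < n" "(\<alpha> - 1) div n < n" "(\<beta> - 1) div n < n"
      using V lt by (auto simp: pverts_Sud)
    have g: "g a b = g \<alpha> \<beta>" using eq V by (simp add: c_def)
    have m1: "((a - 1) mod n + (b - 1) div n) mod n = ((\<alpha> - 1) mod n + (\<beta> - 1) div n) mod n"
      using arg_cong[OF g, of "\<lambda>x. x div n"] n by (simp add: g_def)
    have m2: "((b - 1) mod n + (a - 1) div n) mod n = ((\<beta> - 1) mod n + (\<alpha> - 1) div n) mod n"
      using arg_cong[OF g, of "\<lambda>x. x mod n"] by (simp add: g_def)
    have ext: "x = y" if "(x - 1) div n = (y - 1) div n" "(x - 1) mod n = (y - 1) mod n"
      "x \<ge> 1" "y \<ge> 1" for x y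
      using that by (metis div_mult_mod_eq le_add_diff_inverse)
    have md: "x mod n < n" for x using n by simp
    consider "a = \<alpha>" | "b = \<beta>" |
      "(a - 1) div n = (\<alpha> - 1) div n" "(b - 1) div n = (\<beta> - 1) div n"
      using uv Sud_adjacent_iff[OF V] pos n by (auto simp: ceiling_divide_eq)
    \<comment> \<open>Cancelling the known summands in \<open>m1\<close> and \<open>m2\<close>
      yields quotient and remainder of the free coordinate in the first two cases, and both
      remainders in the third; \<open>ext\<close> reassembles the coordinates.\<close>
    then have "a = \<alpha> \<and> b = \<beta>"
    proof cases
      case 1
      then show ?thesis
        using m1 m2 lts pos md ext add_mod_cancel by (metis add.commute)
    next
      case 2
      then show ?thesis
        using m1 m2 lts pos md ext add_mod_cancel by (metis add.commute)
    next
      case 3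
      then show ?thesis
        using m1 m2 lts pos md ext add_mod_cancel by (metis add.commute)
    qed
    with V show False by simp
  qed
  ultimately have "c \<in> proper_colorings (Sud n) (n\<^sup>2)" by (auto simp: proper_colorings_def)
  then show ?thesis by blast
qed

text \<open>A proper coloring is injective on a clique, and an injection between finite sets of
  equal size is onto. Hence every color occurs in each row, column and block of a colored
  Sudoku.\<close>

lemma proper_coloring_image_clique:
  assumes "c \<in> proper_colorings G k" "Q \<subseteq> pverts G" "card Q = k"
    and "\<And>u v. u \<in> Q \<Longrightarrow> v \<in> Q \<Longrightarrow> u \<noteq> v \<Longrightarrow> (u, v) \<in> parcs G"
  shows "c ` Q = {1..k}"
proof -
  have "inj_on c Q" using assms(1,4) by (fastforce simp: inj_on_def proper_colorings_def)
  then have "card (c ` Q) = card {1..k}" using assms(3) by (simp add: card_image)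
  moreover have "c ` Q \<subseteq> {1..k}" using assms(1,2) by (auto simp: proper_colorings_def)
  ultimately show ?thesis by (simp add: card_subset_eq)
qed

text \<open>The lower bound comes from the first row, a clique on \<open>n\<^sup>2\<close>
  vertices.\<close>

lemma chromatic_number_Sud:
  assumes "n > 0"
  shows "chromatic_number (Sud n) = n\<^sup>2"
  unfolding chromatic_number_def
proof (rule Least_equality)
  show "proper_colorings (Sud n) (n\<^sup>2) \<noteq> {}" by (rule proper_colorings_Sud_nonempty[OF assms])
next
  fix k assume "proper_colorings (Sud n) k \<noteq> {}"
  then obtain c where c: "c \<in> proper_colorings (Sud n) k" by blast
  let ?R = "{1::nat} \<times> {1..n\<^sup>2}"
  have "inj_on c ?R"
  proof (rule inj_onI, rule ccontr)
    fix u v assume uv: "u \<in> ?R" "v \<in> ?R" "c u = c v" "u \<noteq> v"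
    have "(u, v) \<in> parcs (Sud n)" using assms uv by (intro Sud_row_adjacent[of 1]) auto
    with c uv(3) show False by (auto simp: proper_colorings_def)
  qed
  moreover have "c ` ?R \<subseteq> {1..k}"
    using c assms by (auto simp: proper_colorings_def pverts_Sud Pi_def PiE_def)
  ultimately have "card ?R \<le> card {1..k}" by (rule card_inj_on_le) simp
  then show "n\<^sup>2 \<le> k" by (simp add: card_cartesian_product)
qed

section \<open>Occurrences of a color around a cell\<close>

definition color_nbrs where
  "color_nbrs G c u k = {w \<in> pverts G. (u, w) \<in> parcs G \<and> c w = k}"

text \<open>The color \<open>k\<close> occurs in the row, the column and the block of
  \<open>u\<close>. Row and column meet only in \<open>u\<close>, so two occurrences are always
  distinct; with \<open>u\<close> this makes 3 cells. The block occurrence is a further one unless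
  it lies in the row or column of \<open>u\<close>.\<close>

lemma Sud_color_nbrs:
  assumes c: "c \<in> proper_colorings (Sud n) (n\<^sup>2)" and u: "u \<in> pverts (Sud n)"
  obtains E where "finite E" "card E \<le> 2 * n"
    "\<And>k. k \<in> {1..n\<^sup>2} - {c u} \<Longrightarrow> 3 \<le> card (insert u (color_nbrs (Sud n) c u k))"
    "\<And>k. k \<in> {1..n\<^sup>2} - {c u} - E \<Longrightarrow> 4 \<le> card (insert u (color_nbrs (Sud n) c u k))"
proof -
  obtain a b where uab: "u = (a, b)" by (cases u)
  have ab: "a \<in> {1..n\<^sup>2}" "b \<in> {1..n\<^sup>2}" using u by (auto simp: uab pverts_Sud)
  obtain i j where ij: "i < n" "j < n" "a \<in> block n i" "b \<in> block n j"
    using ab unfolding Union_block[symmetric] by blast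
  define R where "R = {a} \<times> {1..n\<^sup>2}"
  define L where "L = {1..n\<^sup>2} \<times> {b}"
  define B where "B = block n i \<times> block n j"
  have sub: "R \<subseteq> pverts (Sud n)" "L \<subseteq> pverts (Sud n)" "B \<subseteq> pverts (Sud n)"
    using ab ij block_subset[of i n] block_subset[of j n]
    by (auto simp: R_def L_def B_def pverts_Sud)
  have adj: "(v, w) \<in> parcs (Sud n)"
    if "v \<in> Q" "w \<in> Q" "v \<noteq> w" "Q \<in> {R, L, B}" for v w Q
    using that Sud_row_adjacent[OF ab(1), of v w] Sud_column_adjacent[OF ab(2), of v w]
      Sud_block_adjacent[OF ij(1,2), of v w]
    unfolding R_def L_def B_def by blast
  have "card Q = n\<^sup>2" if "Q \<in> {R, L, B}" for Q
    using that by (auto simp: R_def L_def B_def card_cartesian_product card_block power2_eq_square)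
  then have img: "c ` Q = {1..n\<^sup>2}" if "Q \<in> {R, L, B}" for Q
    using that sub adj by (intro proper_coloring_image_clique[OF c]) auto
  have uQ: "u \<in> Q" if "Q \<in> {R, L, B}" for Q using that ab ij by (auto simp: uab R_def L_def B_def)
  have ex: "\<exists>w\<in>Q. w \<noteq> u \<and> w \<in> color_nbrs (Sud n) c u k"
    if k: "k \<in> {1..n\<^sup>2} - {c u}" and Q: "Q \<in> {R, L, B}" for k Q
  proof -
    have "k \<in> c ` Q" using k img[OF Q] by simp
    then obtain w where w: "w \<in> Q" "c w = k" by blast
    then have "w \<noteq> u" using k by auto
    then show ?thesis
      using w Q sub adj[OF uQ[OF Q] w(1)] by (auto simp: color_nbrs_def)
  qed
  have fin: "finite (insert u (color_nbrs (Sud n) c u k))" for k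
    by (simp add: color_nbrs_def pverts_Sud)
  have RL: "x = u" if "x \<in> R" "x \<in> L" for x using that by (auto simp: R_def L_def uab)
  \<comment> \<open>The exceptional colors are those on the two segments in which the block meets
    the row and the column of \<open>u\<close>, each of \<open>n\<close> cells.\<close>
  define E where "E = c ` ({a} \<times> block n j \<union> block n i \<times> {b})"
  show ?thesis
  proof (rule that[of E])
    show "finite E" by (simp add: E_def block_def)
    have "card E \<le> card ({a} \<times> block n j \<union> block n i \<times> {b})"
      unfolding E_def by (rule card_image_le) (simp add: block_def)
    also have "\<dots> \<le> card ({a} \<times> block n j) + card (block n i \<times> {b})" by (rule card_Un_le)
    finally show "card E \<le> 2 * n" by (simp add: card_cartesian_product card_block)
  next
    fix k assume k: "k \<in> {1..n\<^sup>2} - {c u}"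
    obtain r s where "r \<in> R" "s \<in> L" "r \<noteq> u" "s \<noteq> u"
      "r \<in> color_nbrs (Sud n) c u k" "s \<in> color_nbrs (Sud n) c u k"
      using ex[OF k, of R] ex[OF k, of L] by auto
    moreover have "r \<noteq> s" using calculation RL by blast
    ultimately have "{u, r, s} \<subseteq> insert u (color_nbrs (Sud n) c u k)" "card {u, r, s} = 3" by auto
    then show "3 \<le> card (insert u (color_nbrs (Sud n) c u k))" by (metis card_mono fin)
  next
    fix k assume k: "k \<in> {1..n\<^sup>2} - {c u} - E"
    then have k': "k \<in> {1..n\<^sup>2} - {c u}" by simp
    obtain r s t where *: "r \<in> R" "s \<in> L" "t \<in> B" "r \<noteq> u" "s \<noteq> u" "t \<noteq> u"
      "r \<in> color_nbrs (Sud n) c u k" "s \<in> color_nbrs (Sud n) c u k" "t \<in> color_nbrs (Sud n) c u k"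
      using ex[OF k', of R] ex[OF k', of L] ex[OF k', of B] by auto
    moreover have "r \<noteq> s" using * RL by blast
    moreover have "t \<notin> R" "t \<notin> L"
    proof -
      have "c t = k" using * by (simp add: color_nbrs_def)
      then have "c t \<notin> E" using k by simp
      then have "t \<notin> {a} \<times> block n j \<union> block n i \<times> {b}" unfolding E_def by blast
      then show "t \<notin> R" "t \<notin> L" using *(3) by (auto simp: B_def R_def L_def)
    qed
    moreover have "t \<noteq> r" "t \<noteq> s" using calculation by blast+
    ultimately have "{u, r, s, t} \<subseteq> insert u (color_nbrs (Sud n) c u k)" "card {u, r, s, t} = 4"
      by auto
    then show "4 \<le> card (insert u (color_nbrs (Sud n) c u k))" by (metis card_mono fin)
  qed
qed

section \<open>From the sampling rate to the bound\<close>

text \<open>The complement of the set \<open>W\<close> from \<open>ex_subset_avoiding\<close>,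
  applied to \<open>color_nbrs\<close>, is determining. The two subtracted terms account for at most
  \<open>n\<^sup>2\<close> colors that need 4 sampled cells and at most \<open>2 * n\<close> that
  may need only 3.\<close>

lemma scs_Sud_le:
  fixes q :: nat
  assumes n: "n > 0" and q: "q > 0" and c: "c \<in> chromatic_colorings (Sud n)"
  shows "real (scs (Sud n) c) \<le> real n ^ 4 -
    real n ^ 4 * (1 / q - (real n ^ 2 * (1 / q) ^ 4 + 2 * real n * (1 / q) ^ 3))"
proof -
  interpret pair_graph "Sud n" by (rule pair_graph_Sud)
  let ?V = "pverts (Sud n)" and ?p = "1 / real q"
  let ?K = "\<lambda>u. {1..n\<^sup>2} - {c u}" and ?T = "color_nbrs (Sud n) c"
  have chi: "chromatic_number (Sud n) = n\<^sup>2" by (rule chromatic_number_Sud[OF n])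
  have c': "c \<in> proper_colorings (Sud n) (n\<^sup>2)" using c by (simp add: chromatic_colorings_def chi)
  have p: "0 \<le> ?p" "?p \<le> 1" using q by auto
  have bad: "(\<Sum>k\<in>?K u. ?p ^ card (insert u (?T u k))) \<le> real n ^ 2 * ?p ^ 4 + 2 * real n * ?p ^ 3"
    if u: "u \<in> ?V" for u
  proof -
    obtain E where E: "finite E" "card E \<le> 2 * n"
      "\<And>k. k \<in> ?K u \<Longrightarrow> 3 \<le> card (insert u (?T u k))"
      "\<And>k. k \<in> ?K u - E \<Longrightarrow> 4 \<le> card (insert u (?T u k))"
      using Sud_color_nbrs[OF c' u] by metis
    \<comment> \<open>As \<open>?p \<le> 1\<close>, lower bounds on the cardinalities give upper
      bounds on the powers.\<close>
    have "(\<Sum>k\<in>?K u. ?p ^ card (insert u (?T u k))) \<le>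
        (\<Sum>k\<in>?K u. ?p ^ 4 + (if k \<in> E then ?p ^ 3 else 0))"
    proof (rule sum_mono)
      fix k assume k: "k \<in> ?K u"
      show "?p ^ card (insert u (?T u k)) \<le> ?p ^ 4 + (if k \<in> E then ?p ^ 3 else 0)"
        using power_decreasing[OF E(3)[OF k] p] power_decreasing[OF E(4) p, of k] k p
        by (auto intro: add_increasing)
    qed
    also have "\<dots> \<le> (\<Sum>k\<in>{1..n\<^sup>2}. ?p ^ 4) + (\<Sum>k\<in>E. ?p ^ 3)"
    proof -
      have "(\<Sum>k\<in>?K u. ?p ^ 4) \<le> (\<Sum>k\<in>{1..n\<^sup>2}. ?p ^ 4)"
        by (rule sum_mono2) auto
      moreover have "(\<Sum>k\<in>?K u. if k \<in> E then ?p ^ 3 else 0) = (\<Sum>k\<in>?K u \<inter> E. ?p ^ 3)"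
        by (rule sum.inter_restrict[symmetric]) simp
      moreover have "\<dots> \<le> (\<Sum>k\<in>E. ?p ^ 3)"
        using E(1) by (intro sum_mono2) auto
      ultimately show ?thesis by (simp only: sum.distrib)
    qed
    also have "\<dots> \<le> real n ^ 2 * ?p ^ 4 + 2 * real n * ?p ^ 3"
    proof -
      have "real (card E) * ?p ^ 3 \<le> real (2 * n) * ?p ^ 3"
        using E(2) by (intro mult_right_mono of_nat_mono) auto
      then show ?thesis by simp
    qed
    finally show ?thesis .
  qed
  obtain W where W: "W \<subseteq> ?V" "\<And>v k. v \<in> W \<Longrightarrow> k \<in> ?K v \<Longrightarrow> \<not> ?T v k \<subseteq> W"
    "real (card W) \<ge> (\<Sum>v\<in>?V. ?p - (\<Sum>k\<in>?K v. ?p ^ card (insert v (?T v k))))"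
    by (rule ex_subset_avoiding[of ?V q ?K ?T]) (auto simp: q pverts_Sud color_nbrs_def)
  have V: "card ?V = n ^ 4" "finite ?V" by (simp_all add: pverts_Sud card_cartesian_product power_mult_distrib flip: power_add)
  have "determining_set (Sud n) c (?V - W)"
  proof (rule determining_set_Diff[OF c W(1)])
    fix u k assume "u \<in> W" "k \<in> {1..chromatic_number (Sud n)} - {c u}"
    then have "\<not> ?T u k \<subseteq> W" using W(2) by (simp add: chi)
    then show "\<exists>w\<in>?V - W. (u, w) \<in> parcs (Sud n) \<and> c w = k"
      by (auto simp: color_nbrs_def)
  qed
  then have "scs (Sud n) c \<le> card (?V - W)" by (rule scs_le_card_determining)
  also have "\<dots> = n ^ 4 - card W"
    using W(1) V by (simp add: card_Diff_subset finite_subset)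
  finally have "real (scs (Sud n) c) \<le> real n ^ 4 - real (card W)"
    using card_mono[OF V(2) W(1)] V(1) by (simp flip: of_nat_power)
  moreover have "real (card W) \<ge>
      real n ^ 4 * (?p - (real n ^ 2 * ?p ^ 4 + 2 * real n * ?p ^ 3))"
  proof -
    have "(\<Sum>v\<in>?V. ?p - (real n ^ 2 * ?p ^ 4 + 2 * real n * ?p ^ 3)) \<le>
        (\<Sum>v\<in>?V. ?p - (\<Sum>k\<in>?K v. ?p ^ card (insert v (?T v k))))"
      using bad by (intro sum_mono diff_left_mono)
    with W(3) show ?thesis by (simp add: V(1))
  qed
  ultimately show ?thesis by linarith
qed

text \<open>With \<open>q\<close> close to \<open>2 * x\<close> for
  \<open>x = real n powr (2 / 3)\<close>, the losses relative to \<open>1 / q\<close> are at most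
  \<open>1 / 8\<close> and \<open>1 / 2\<close>, so the fraction \<open>3 / 8\<close>
  remains.\<close>

lemma sampling_rate:
  fixes n :: nat
  assumes "n > 0"
  obtains q :: nat where "q > 0"
    "1 / q - (real n ^ 2 * (1 / q) ^ 4 + 2 * real n * (1 / q) ^ 3) \<ge> 1 / 8 * real n powr (- 2 / 3)"
proof -
  define x where "x = real n powr (2 / 3)"
  define q where "q = nat \<lceil>2 * x\<rceil>"
  have x: "x \<ge> 1" using assms by (simp add: x_def ge_one_powr_ge_zero)
  have x3: "x ^ 3 = real n ^ 2"
  proof -
    have "x ^ 3 = x powr 3" using x by simp
    also have "\<dots> = real n powr 2" by (simp add: x_def powr_powr)
    finally show ?thesis using assms by simp
  qed
  have x2: "real n \<le> x\<^sup>2"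
  proof -
    have "real n powr 1 \<le> real n powr (4 / 3)" using assms by (intro powr_mono) auto
    also have "\<dots> = x powr 2" by (simp add: x_def powr_powr)
    also have "\<dots> = x\<^sup>2" using x by simp
    finally show ?thesis by simp
  qed
  \<comment> \<open>Rounding up adds less than 1, which is at most \<open>x\<close>. The factor 3
    then turns \<open>3 / 8\<close> into the final constant \<open>1 / 8\<close>.\<close>
  have q: "2 * x \<le> real q" "real q \<le> 3 * x" using x unfolding q_def by linarith+
  then have q0: "real q > 0" using x by linarith
  have "(2 * x) ^ 3 \<le> real q ^ 3" "(2 * x) ^ 2 \<le> real q ^ 2" using q(1) x by (intro power_mono; simp)+
  then have q3: "real n ^ 2 / real q ^ 3 \<le> 1 / 8" and q2: "2 * real n / real q ^ 2 \<le> 1 / 2"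
    using q0 x2 x3 by (auto simp: field_simps)
  have "1 / 8 * real n powr (- 2 / 3) = 1 / (3 * x) * (3 / 8)"
    by (simp add: x_def powr_minus_divide)
  also have "\<dots> \<le> 1 / real q * (3 / 8)" using q q0 by (intro mult_right_mono divide_left_mono) auto
  also have "\<dots> \<le> 1 / real q * (1 - (real n ^ 2 / real q ^ 3 + 2 * real n / real q ^ 2))"
  proof (intro mult_left_mono)
    show "3 / 8 \<le> 1 - (real n ^ 2 / real q ^ 3 + 2 * real n / real q ^ 2)"
      using q2 q3 by linarith
  qed simp
  also have "\<dots> = 1 / q - (real n ^ 2 * (1 / q) ^ 4 + 2 * real n * (1 / q) ^ 3)"
    using q0 by (simp add: field_simps power_numeral_reduce)
  finally show ?thesis using q0 by (intro that[of q]) auto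
qed

theorem theorem11:
  shows "\<exists>C::real. C > 0 \<and> (\<exists>n\<^sub>0::nat. \<forall>n\<ge>n\<^sub>0.
    real (scs_bar (Sud n)) \<le> real n ^ 4 - C * real n powr (10 / 3))"
proof (intro exI[of _ "1 / 8"] conjI exI[of _ 1] allI impI)
  fix n :: nat assume "1 \<le> n"
  then have n: "n > 0" by simp
  interpret pair_graph "Sud n" by (rule pair_graph_Sud)
  obtain c where c: "c \<in> chromatic_colorings (Sud n)" "scs_bar (Sud n) = scs (Sud n) c"
    by (rule scs_bar_attained)
  obtain q :: nat where q: "q > 0"
    "1 / q - (real n ^ 2 * (1 / q) ^ 4 + 2 * real n * (1 / q) ^ 3) \<ge> 1 / 8 * real n powr (- 2 / 3)"
    using sampling_rate[OF n] by blast
  \<comment> \<open>The exponent splits as 4 for the number of cells and \<open>- 2 / 3\<close> for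
    the rate of gain per cell.\<close>
  have "real n powr (10 / 3) = real n powr 4 * real n powr (- 2 / 3)"
    by (subst powr_add[symmetric]) simp
  then have "1 / 8 * real n powr (10 / 3) = real n ^ 4 * (1 / 8 * real n powr (- 2 / 3))"
    using n by simp
  also have "\<dots> \<le> real n ^ 4 * (1 / q - (real n ^ 2 * (1 / q) ^ 4 + 2 * real n * (1 / q) ^ 3))"
    using q(2) by (rule mult_left_mono) simp
  finally show "real (scs_bar (Sud n)) \<le> real n ^ 4 - 1 / 8 * real n powr (10 / 3)"
    using scs_Sud_le[OF n q(1) c(1)] c(2) by linarith
qed simp

end
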